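(* Let $n\ge 1$ and let $g$ be the Semi-Riemannian metric on $GL_n=GL_n(\mathbb{R})$ given by $g_A(V,W)=\mathrm{tr}(A^{-1}VA^{-1}W)$ for $A\in GL_n$, $V,W\in T_A(GL_n)=M_n(\mathbb{R})$. 1) Let $\nabla$ be the Levi-Civita connection of $(GL_n,g)$. If $X$ and $Y$ are tangent vector fields of class $C^\infty$ on $GL_n$, then $$(\nabla_XY)_P=(X(Y))_P-\tfrac12\left(X_PP^{-1}Y_P+Y_PP^{-1}X_P\right)$$ for any $P\in GL_n$, where $X(Y)$ is the euclidean derivative of $Y$ with respect to $X$. 2) Let $P=P(t)$ be a $C^\infty$ curve in $(GL_n,g)$. Then $P$ is a geodesic if and only if $$\nabla_{\dot P}\dot P=\ddot P-\dot PP^{-1}\dot P=0,$$ where $\dot P$ and $\ddot P$ are the first and the second derivative of $P$ with respect to $t$. 3) The geodesics of $(GL_n,g)$ are precisely the curves of the type $P(t)=Ke^{tC}$, for any $C\in M_n(\mathbb{R})$ and any $K\in GL_n$. 4) $(GL_n,g)$ is a geodesically complete Semi-Riemannian manifold.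
   Context: $M_n(\mathbb{R})$ is the space of real $n\times n$ matrices; $GL_n(\mathbb{R})$ is open in it, so a tangent vector field on $GL_n$ is a map $GL_n\to M_n(\mathbb{R})$. Let $\{E_\alpha\}_{1\le\alpha\le n^2}$ be the standard basis of $M_n(\mathbb{R})$ (matrices with a single nonzero entry equal to $1$) and $P=\sum_\alpha p^\alpha E_\alpha$, so that $(p^\alpha)$ are global coordinates on $GL_n$ and $E_\alpha$ is identified with $\partial/\partial p^\alpha$. For vector fields $X=\sum_\alpha X^\alpha E_\alpha$, $Y=\sum_\alpha Y^\alpha E_\alpha$, the euclidean derivative of $Y$ along $X$ is $X(Y)=\sum_{\alpha,\beta}X^\alpha\frac{\partial Y^\beta}{\partial p^\alpha}E_\beta$. Constant curves are regarded as geodesics, and in 3) geodesics are understood as maximal ones, defined on their maximal interval. *)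

theory Defs
  imports "HOL-Analysis.Analysis"
begin

section \<open>Smooth maps on open subsets of Euclidean spaces\<close>

fun Ck_on :: "nat \<Rightarrow> 'a::euclidean_space set \<Rightarrow> ('a \<Rightarrow> 'b::euclidean_space) \<Rightarrow> bool" where
  "Ck_on 0 U f \<longleftrightarrow> continuous_on U f"
| "Ck_on (Suc k) U f \<longleftrightarrow>
     (\<forall>x\<in>U. f differentiable (at x)) \<and>
     (\<forall>v. Ck_on k U (\<lambda>x. frechet_derivative f (at x) v))"

text \<open>Class $C^\infty$; meant only for open \<open>U\<close>.\<close>

definition smooth_on :: "'a::euclidean_space set \<Rightarrow> ('a \<Rightarrow> 'b::euclidean_space) \<Rightarrow> bool" where
  "smooth_on U f \<longleftrightarrow> (\<forall>k. Ck_on k U f)"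

definition partial_deriv :: "'a::euclidean_space \<Rightarrow> ('a \<Rightarrow> real) \<Rightarrow> 'a \<Rightarrow> real" where
  "partial_deriv a f p = deriv (\<lambda>s. f (p + s *\<^sub>R a)) 0"

text \<open>
  \<open>X(Y)\<close> in the global coordinates given by the standard basis. For scalar \<open>Y\<close> (where
  \<open>Basis = {1}\<close>) this is the usual action of a vector field on a function. On
  \<open>real^'n^'n\<close>, \<open>Basis\<close> consists of the matrices with a single nonzero entry equal to \<open>1\<close>
  and \<open>A \<bullet> b\<close> is the corresponding entry of \<open>A\<close>.
\<close>

definition euclidean_derivative ::
    "('a::euclidean_space \<Rightarrow> 'a) \<Rightarrow> ('a \<Rightarrow> 'b::euclidean_space) \<Rightarrow> 'a \<Rightarrow> 'b" where
  "euclidean_derivative X Y p =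
     (\<Sum>a\<in>Basis. \<Sum>b\<in>Basis. ((X p \<bullet> a) * partial_deriv a (\<lambda>q. Y q \<bullet> b) p) *\<^sub>R b)"

definition lie_bracket :: "('a::euclidean_space \<Rightarrow> 'a) \<Rightarrow> ('a \<Rightarrow> 'a) \<Rightarrow> 'a \<Rightarrow> 'a" where
  "lie_bracket X Y p = euclidean_derivative X Y p - euclidean_derivative Y X p"


section \<open>Semi-Riemannian geometry of an open subset of a Euclidean space\<close>

text \<open>
  The manifold is an open set \<open>U\<close>, all tangent spaces are identified with the ambient space,
  and a tensor field is a total function of which only the values at points of \<open>U\<close> matter.
\<close>

definition form_index :: "('a::euclidean_space \<Rightarrow> 'a \<Rightarrow> real) \<Rightarrow> nat" where
  "form_index B = Max {dim S | S. subspace S \<and> (\<forall>v\<in>S. v \<noteq> 0 \<longrightarrow> B v v < 0)}"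

definition semi_riemannian_manifold ::
    "'a::euclidean_space set \<Rightarrow> ('a \<Rightarrow> 'a \<Rightarrow> 'a \<Rightarrow> real) \<Rightarrow> bool" where
  "semi_riemannian_manifold U g \<longleftrightarrow>
     open U \<and>
     (\<forall>v w. smooth_on U (\<lambda>p. g p v w)) \<and>
     (\<forall>p\<in>U. bilinear (g p)) \<and>
     (\<forall>p\<in>U. \<forall>v w. g p v w = g p w v) \<and>
     (\<forall>p\<in>U. \<forall>v. (\<forall>w. g p v w = 0) \<longrightarrow> v = 0) \<and>
     (\<exists>k. \<forall>p\<in>U. form_index (g p) = k)"

text \<open>
  The first two clauses say that \<open>D\<close> is a well-defined operator on smooth vector fields on \<open>U\<close>.
\<close>

definition connection_on ::
    "'a::euclidean_space set \<Rightarrow> (('a \<Rightarrow> 'a) \<Rightarrow> ('a \<Rightarrow> 'a) \<Rightarrow> 'a \<Rightarrow> 'a) \<Rightarrow> bool" where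
  "connection_on U D \<longleftrightarrow>
     (\<forall>X Y. smooth_on U X \<longrightarrow> smooth_on U Y \<longrightarrow> smooth_on U (D X Y)) \<and>
     (\<forall>X X' Y Y'. smooth_on U X \<longrightarrow> smooth_on U Y \<longrightarrow>
        (\<forall>p\<in>U. X' p = X p \<and> Y' p = Y p) \<longrightarrow> (\<forall>p\<in>U. D X' Y' p = D X Y p)) \<and>
     (\<forall>X X' Y. smooth_on U X \<longrightarrow> smooth_on U X' \<longrightarrow> smooth_on U Y \<longrightarrow>
        (\<forall>p\<in>U. D (\<lambda>q. X q + X' q) Y p = D X Y p + D X' Y p)) \<and>
     (\<forall>(f::'a \<Rightarrow> real) X Y. smooth_on U f \<longrightarrow> smooth_on U X \<longrightarrow> smooth_on U Y \<longrightarrow>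
        (\<forall>p\<in>U. D (\<lambda>q. f q *\<^sub>R X q) Y p = f p *\<^sub>R D X Y p)) \<and>
     (\<forall>X Y Y'. smooth_on U X \<longrightarrow> smooth_on U Y \<longrightarrow> smooth_on U Y' \<longrightarrow>
        (\<forall>p\<in>U. D X (\<lambda>q. Y q + Y' q) p = D X Y p + D X Y' p)) \<and>
     (\<forall>c X Y. smooth_on U X \<longrightarrow> smooth_on U Y \<longrightarrow>
        (\<forall>p\<in>U. D X (\<lambda>q. c *\<^sub>R Y q) p = c *\<^sub>R D X Y p)) \<and>
     (\<forall>(f::'a \<Rightarrow> real) X Y. smooth_on U f \<longrightarrow> smooth_on U X \<longrightarrow> smooth_on U Y \<longrightarrow>
        (\<forall>p\<in>U. D X (\<lambda>q. f q *\<^sub>R Y q) p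
               = euclidean_derivative X f p *\<^sub>R Y p + f p *\<^sub>R D X Y p))"

definition levi_civita_connection ::
    "'a::euclidean_space set \<Rightarrow> ('a \<Rightarrow> 'a \<Rightarrow> 'a \<Rightarrow> real) \<Rightarrow>
     (('a \<Rightarrow> 'a) \<Rightarrow> ('a \<Rightarrow> 'a) \<Rightarrow> 'a \<Rightarrow> 'a) \<Rightarrow> bool" where
  "levi_civita_connection U g D \<longleftrightarrow>
     connection_on U D \<and>
     (\<forall>X Y. smooth_on U X \<longrightarrow> smooth_on U Y \<longrightarrow>
        (\<forall>p\<in>U. lie_bracket X Y p = D X Y p - D Y X p)) \<and>
     (\<forall>X Y Z. smooth_on U X \<longrightarrow> smooth_on U Y \<longrightarrow> smooth_on U Z \<longrightarrow>
        (\<forall>p\<in>U. euclidean_derivative X (\<lambda>q. g q (Y q) (Z q)) p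
               = g p (D X Y p) (Z p) + g p (Y p) (D X Z p)))"

text \<open>
  The Levi-Civita connection exists and is unique as an operator on smooth vector fields on \<open>U\<close>.
  Its values on other arguments and off \<open>U\<close> are irrelevant, so \<open>SOME\<close> rather than \<open>THE\<close> is
  used to pick a total function representing it.
\<close>

definition levi_civita ::
    "'a::euclidean_space set \<Rightarrow> ('a \<Rightarrow> 'a \<Rightarrow> 'a \<Rightarrow> real) \<Rightarrow>
     ('a \<Rightarrow> 'a) \<Rightarrow> ('a \<Rightarrow> 'a) \<Rightarrow> 'a \<Rightarrow> 'a" where
  "levi_civita U g = (SOME D. levi_civita_connection U g D)"

definition velocity :: "(real \<Rightarrow> 'a::euclidean_space) \<Rightarrow> real \<Rightarrow> 'a" where
  "velocity c t = vector_derivative c (at t)"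

text \<open>
  The covariant derivative along \<open>c\<close> of a vector field \<open>V\<close> along \<open>c\<close>, induced by \<open>D\<close>:
  the coordinate formula
  $\sum_k \bigl(\dot V^k + \sum_{i,j} \Gamma^k_{ij}\,\dot c^i V^j\bigr)\,\partial_k$,
  where $D_{\partial_i}\partial_j = \sum_k \Gamma^k_{ij}\,\partial_k$.
\<close>

definition cov_deriv_along ::
    "(('a::euclidean_space \<Rightarrow> 'a) \<Rightarrow> ('a \<Rightarrow> 'a) \<Rightarrow> 'a \<Rightarrow> 'a) \<Rightarrow>
     (real \<Rightarrow> 'a) \<Rightarrow> (real \<Rightarrow> 'a) \<Rightarrow> real \<Rightarrow> 'a" where
  "cov_deriv_along D c V t =
     velocity V t +
     (\<Sum>i\<in>Basis. \<Sum>j\<in>Basis. ((velocity c t \<bullet> i) * (V t \<bullet> j)) *\<^sub>R D (\<lambda>_. i) (\<lambda>_. j) (c t))"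

definition smooth_curve ::
    "'a::euclidean_space set \<Rightarrow> real set \<Rightarrow> (real \<Rightarrow> 'a) \<Rightarrow> bool" where
  "smooth_curve U I c \<longleftrightarrow>
     open I \<and> is_interval I \<and> I \<noteq> {} \<and> (\<forall>t\<in>I. c t \<in> U) \<and> smooth_on I c"

definition geodesic ::
    "'a::euclidean_space set \<Rightarrow> ('a \<Rightarrow> 'a \<Rightarrow> 'a \<Rightarrow> real) \<Rightarrow> real set \<Rightarrow> (real \<Rightarrow> 'a) \<Rightarrow> bool" where
  "geodesic U g I c \<longleftrightarrow>
     smooth_curve U I c \<and> (\<forall>t\<in>I. cov_deriv_along (levi_civita U g) c (velocity c) t = 0)"

definition maximal_geodesic ::
    "'a::euclidean_space set \<Rightarrow> ('a \<Rightarrow> 'a \<Rightarrow> 'a \<Rightarrow> real) \<Rightarrow> real set \<Rightarrow> (real \<Rightarrow> 'a) \<Rightarrow> bool" where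
  "maximal_geodesic U g I c \<longleftrightarrow>
     geodesic U g I c \<and>
     (\<forall>J c'. geodesic U g J c' \<longrightarrow> I \<subseteq> J \<longrightarrow> (\<forall>t\<in>I. c' t = c t) \<longrightarrow> J = I)"

definition geodesically_complete ::
    "'a::euclidean_space set \<Rightarrow> ('a \<Rightarrow> 'a \<Rightarrow> 'a \<Rightarrow> real) \<Rightarrow> bool" where
  "geodesically_complete U g \<longleftrightarrow> (\<forall>I c. maximal_geodesic U g I c \<longrightarrow> I = UNIV)"


section \<open>The general linear group and the trace metric\<close>

definition GL :: "(real^'n^'n) set" where
  "GL = {A. invertible A}"

definition trace_metric :: "real^'n^'n \<Rightarrow> real^'n^'n \<Rightarrow> real^'n^'n \<Rightarrow> real" where
  "trace_metric A V W = trace (matrix_inv A ** V ** matrix_inv A ** W)"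

text \<open>
  The matrix exponential. The library's \<open>exp\<close> and \<open>^\<close> are not usable here, since
  multiplication on type \<open>vec\<close> is componentwise.
\<close>

definition matrix_exp :: "real^'n^'n \<Rightarrow> real^'n^'n" where
  "matrix_exp A = (\<Sum>k. (1 / fact k) *\<^sub>R (((**) A) ^^ k) (mat 1))"

end

theory Submission
  imports Defs
begin

text \<open>
  The claimed formula for the connection is checked to define a torsion-free metric connection; cyclicity of the
  trace is what makes it compatible with \<open>g\<close>. Since its Christoffel terms at \<open>P\<close> are
  \<open>-(E\<^sub>i P\<^sup>-\<^sup>1 E\<^sub>j + E\<^sub>j P\<^sup>-\<^sup>1 E\<^sub>i)/2\<close>, the geodesic equation is \<open>P'' = P' P\<^sup>-\<^sup>1 P'\<close>, which says exactly that
  \<open>P\<^sup>-\<^sup>1 P'\<close> is a constant \<open>C\<close>. Hence \<open>P' = P C\<close> and \<open>P = K e\<^sup>t\<^sup>C\<close>, which exists for all times. Left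
  multiplication by \<open>A\<close> is an isometry from the form at the identity to the form at \<open>A\<close>, so the
  index need not be computed to be seen constant.
\<close>

section \<open>Calculus of smooth maps\<close>

lemma Ck_on_Suc_D: "Ck_on (Suc k) U f \<Longrightarrow> Ck_on k U f"
proof (induction k arbitrary: f)
  case 0
  then show ?case
    by (auto intro!: continuous_at_imp_continuous_on differentiable_imp_continuous_within)
qed simp

text \<open>Derivatives are local, so on an open set they do not see the values of a total function
  elsewhere. This lets a field be replaced by a formula that is valid only on
  \<open>U\<close>.\<close>

lemma Ck_on_cong:
  assumes "open U" "\<And>x. x \<in> U \<Longrightarrow> f x = g x" "Ck_on k U f"
  shows "Ck_on k U g"
  using assms(2,3)
proof (induction k arbitrary: f g)
  case 0
  then show ?case by (simp cong: continuous_on_cong)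
next
  case (Suc k)
  have d: "g differentiable (at x)" if "x \<in> U" for x
  proof -
    from Suc.prems that obtain D where "(f has_derivative D) (at x)"
      by (auto simp: differentiable_def)
    then have "(g has_derivative D) (at x)"
      by (rule has_derivative_transform_within_open[OF _ assms(1) that Suc.prems(1)])
    then show ?thesis by (auto simp: differentiable_def)
  qed
  have "frechet_derivative f (at x) = frechet_derivative g (at x)" if "x \<in> U" for x
    using frechet_derivative_transform_within_open[OF _ assms(1) that, of f g] Suc.prems that by auto
  then have "Ck_on k U (\<lambda>x. frechet_derivative g (at x) v)" for v
    using Suc.IH[of "\<lambda>x. frechet_derivative f (at x) v" "\<lambda>x. frechet_derivative g (at x) v"]
      Suc.prems(2) by auto
  with d show ?case by simp
qed

text \<open>By uniqueness of derivatives any explicit \<open>D\<close> may stand in for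
  \<open>frechet_derivative\<close>. The inductions below feed in the sum rule, the product rule and
  the derivative of inversion this way.\<close>

lemma Ck_on_SucI:
  assumes "open U" "\<And>x. x \<in> U \<Longrightarrow> (f has_derivative D x) (at x)"
    "\<And>v. Ck_on k U (\<lambda>x. D x v)"
  shows "Ck_on (Suc k) U f"
proof -
  have "D x = frechet_derivative f (at x)" if "x \<in> U" for x
    by (rule frechet_derivative_at[OF assms(2)[OF that]])
  then have "Ck_on k U (\<lambda>x. frechet_derivative f (at x) v)" for v
    using Ck_on_cong[OF assms(1) _ assms(3)] by auto
  moreover have "f differentiable (at x)" if "x \<in> U" for x
    using assms(2)[OF that] by (auto simp: differentiable_def)
  ultimately show ?thesis by simp
qed

lemma Ck_on_const: "Ck_on k U (\<lambda>_. c)"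
  by (induction k arbitrary: c) auto

lemma Ck_on_add:
  assumes "open U" "Ck_on k U f" "Ck_on k U g"
  shows "Ck_on k U (\<lambda>x. f x + g x)"
  using assms(2,3)
proof (induction k arbitrary: f g)
  case 0
  then show ?case by (auto intro: continuous_on_add)
next
  case (Suc k)
  show ?case
    by (rule Ck_on_SucI[OF assms(1)
      has_derivative_add[OF frechet_derivative_works[THEN iffD1] frechet_derivative_works[THEN iffD1]]])
      (use Suc in auto)
qed

text \<open>The product rule expresses the derivative by two further products under
  \<open>h\<close>, so the induction runs over all \<open>f\<close> and \<open>g\<close>. Scaling,
  inner product and matrix product are the instances used.\<close>

lemma Ck_on_bilinear:
  fixes h :: "'b::euclidean_space \<Rightarrow> 'c::euclidean_space \<Rightarrow> 'd::euclidean_space"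
  assumes "open U" "bounded_bilinear h" "Ck_on k U f" "Ck_on k U g"
  shows "Ck_on k U (\<lambda>x. h (f x) (g x))"
  using assms(3,4)
proof (induction k arbitrary: f g)
  case 0
  then show ?case by (auto intro: bounded_bilinear.continuous_on[OF assms(2)])
next
  case (Suc k)
  show ?case
  proof (rule Ck_on_SucI[OF assms(1)
      bounded_bilinear.FDERIV[OF assms(2) frechet_derivative_works[THEN iffD1] frechet_derivative_works[THEN iffD1]]])
    show "Ck_on k U (\<lambda>x. h (f x) (frechet_derivative g (at x) v) + h (frechet_derivative f (at x) v) (g x))" for v
      using Suc.prems
      by (intro Ck_on_add[OF assms(1)] Suc.IH)
        (auto intro: Ck_on_Suc_D simp del: Ck_on.simps(2) simp: Ck_on.simps(2)[of k U f] Ck_on.simps(2)[of k U g])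
  qed (use Suc.prems in auto)
qed

lemma Ck_on_linear:
  fixes h :: "'b::euclidean_space \<Rightarrow> 'c::euclidean_space"
  assumes "open U" "linear h" "Ck_on k U f"
  shows "Ck_on k U (\<lambda>x. h (f x))"
proof -
  have "bounded_linear h" using assms(2) by (rule linear_conv_bounded_linear[THEN iffD1])
  \<comment> \<open>A linear map is a bilinear one with its scalar argument frozen at
    \<open>1\<close>.\<close>
  then have "bounded_bilinear (\<lambda>(r::real) x. r *\<^sub>R h x)"
    by (rule bounded_bilinear.comp[OF bounded_bilinear_scaleR bounded_linear_ident])
  from Ck_on_bilinear[OF assms(1) this Ck_on_const[of k U 1] assms(3)] show ?thesis by simp
qed

section \<open>Closure properties of class C^infinity\<close>

lemma smooth_on_cong: "open U \<Longrightarrow> (\<And>x. x \<in> U \<Longrightarrow> f x = g x) \<Longrightarrow> smooth_on U f \<Longrightarrow> smooth_on U g"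
  unfolding smooth_on_def using Ck_on_cong[of U f g] by blast

lemma smooth_on_const: "smooth_on U (\<lambda>_. c)"
  by (simp add: smooth_on_def Ck_on_const)

lemma smooth_on_add: "open U \<Longrightarrow> smooth_on U f \<Longrightarrow> smooth_on U g \<Longrightarrow> smooth_on U (\<lambda>x. f x + g x)"
  by (simp add: smooth_on_def Ck_on_add)

lemma smooth_on_bilinear:
  fixes h :: "'b::euclidean_space \<Rightarrow> 'c::euclidean_space \<Rightarrow> 'd::euclidean_space"
  shows "open U \<Longrightarrow> bounded_bilinear h \<Longrightarrow> smooth_on U f \<Longrightarrow> smooth_on U g \<Longrightarrow> smooth_on U (\<lambda>x. h (f x) (g x))"
  by (simp add: smooth_on_def Ck_on_bilinear)

lemma smooth_on_linear:
  fixes h :: "'b::euclidean_space \<Rightarrow> 'c::euclidean_space"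
  shows "open U \<Longrightarrow> linear h \<Longrightarrow> smooth_on U f \<Longrightarrow> smooth_on U (\<lambda>x. h (f x))"
  by (simp add: smooth_on_def Ck_on_linear)

lemma smooth_on_diff: 
  assumes "open U" "smooth_on U f" "smooth_on U g"
  shows "smooth_on U (\<lambda>x. f x - g x)"
  using smooth_on_add[OF assms(1,2) smooth_on_linear[OF assms(1) _ assms(3), of uminus]]
  by (simp add: linear_iff)

lemma smooth_on_sum:
  "open U \<Longrightarrow> (\<And>i. i \<in> A \<Longrightarrow> smooth_on U (f i)) \<Longrightarrow> smooth_on U (\<lambda>x. \<Sum>i\<in>A. f i x)"
  by (induction A rule: infinite_finite_induct) (auto intro: smooth_on_const smooth_on_add)

lemma smooth_on_differentiable: "smooth_on U f \<Longrightarrow> x \<in> U \<Longrightarrow> f differentiable (at x)"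
  by (metis smooth_on_def Ck_on.simps(2))

lemma smooth_on_has_derivative:
  "smooth_on U f \<Longrightarrow> x \<in> U \<Longrightarrow> (f has_derivative frechet_derivative f (at x)) (at x)"
  using smooth_on_differentiable frechet_derivative_works by blast

lemma smooth_on_frechet_derivative: "smooth_on U f \<Longrightarrow> smooth_on U (\<lambda>x. frechet_derivative f (at x) v)"
  by (metis smooth_on_def Ck_on.simps(2))

text \<open>By the chain rule along \<open>p + s *\<^sub>R a\<close>, each partial derivative is a
  component of \<open>f' a\<close>, and expansion in \<open>Basis\<close> collapses the double sum.
  From here on, derivative rules replace coordinates.\<close>

lemma euclidean_derivative_eq:
  assumes "(f has_derivative f') (at p)"
  shows "euclidean_derivative X f p = f' (X p)"
proof -
  have lin: "linear f'" using assms has_derivative_linear by blast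
  have pd: "partial_deriv a (\<lambda>q. f q \<bullet> b) p = f' a \<bullet> b" for a b
  proof -
    have 1: "((\<lambda>s::real. p + s *\<^sub>R a) has_derivative (\<lambda>s. s *\<^sub>R a)) (at 0)"
      by (auto intro!: derivative_eq_intros)
    have "((\<lambda>s. f (p + s *\<^sub>R a)) has_derivative (\<lambda>s. f' (s *\<^sub>R a))) (at 0)"
      using diff_chain_at[OF 1, of f f'] assms by (simp add: o_def)
    then have "((\<lambda>s. f (p + s *\<^sub>R a) \<bullet> b) has_derivative (\<lambda>s. f' (s *\<^sub>R a) \<bullet> b)) (at 0)"
      by (rule has_derivative_inner_left)
    then have "((\<lambda>s. f (p + s *\<^sub>R a) \<bullet> b) has_field_derivative (f' a \<bullet> b)) (at 0)"
      by (simp add: has_field_derivative_def linear_cmul[OF lin] mult.commute[of _ "f' a \<bullet> b"])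
    then show ?thesis unfolding partial_deriv_def by (rule DERIV_imp_deriv)
  qed
  have "euclidean_derivative X f p = (\<Sum>a\<in>Basis. (X p \<bullet> a) *\<^sub>R (\<Sum>b\<in>Basis. (f' a \<bullet> b) *\<^sub>R b))"
    unfolding euclidean_derivative_def pd by (simp add: scaleR_sum_right)
  also have "\<dots> = f' (\<Sum>a\<in>Basis. (X p \<bullet> a) *\<^sub>R a)"
    by (simp only: euclidean_representation[of "f' _"] linear_sum[OF lin] linear_cmul[OF lin])
  finally show ?thesis by (simp add: euclidean_representation)
qed

lemma smooth_on_euclidean_derivative:
  assumes "open U" "smooth_on U X" "smooth_on U f"
  shows "smooth_on U (euclidean_derivative X f)"
proof (rule smooth_on_cong[OF assms(1)])
  \<comment> \<open>Smoothness of the Frechet derivative is available only in a fixed direction, so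
    \<open>X p\<close> is expanded in \<open>Basis\<close>.\<close>
  show "(\<Sum>a\<in>Basis. (X p \<bullet> a) *\<^sub>R frechet_derivative f (at p) a) = euclidean_derivative X f p" if "p \<in> U" for p
  proof -
    note d = smooth_on_has_derivative[OF assms(3) that]
    have lin: "linear (frechet_derivative f (at p))" using d has_derivative_linear by blast
    have "euclidean_derivative X f p = frechet_derivative f (at p) (\<Sum>a\<in>Basis. (X p \<bullet> a) *\<^sub>R a)"
      by (simp add: euclidean_representation euclidean_derivative_eq[OF d])
    also have "\<dots> = (\<Sum>a\<in>Basis. (X p \<bullet> a) *\<^sub>R frechet_derivative f (at p) a)"
      by (simp only: linear_sum[OF lin] linear_cmul[OF lin])
    finally show ?thesis by simp
  qed
  show "smooth_on U (\<lambda>p. \<Sum>a\<in>Basis. (X p \<bullet> a) *\<^sub>R frechet_derivative f (at p) a)"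
    by (intro smooth_on_sum smooth_on_bilinear[OF _ bounded_bilinear_scaleR]
        smooth_on_bilinear[OF _ bounded_bilinear_inner] smooth_on_frechet_derivative smooth_on_const assms)
qed

lemma euclidean_derivative_cong:
  assumes "open U" "p \<in> U" "smooth_on U f" "\<And>q. q \<in> U \<Longrightarrow> f' q = f q" "X' p = X p"
  shows "euclidean_derivative X' f' p = euclidean_derivative X f p"
proof -
  note d = smooth_on_has_derivative[OF assms(3,2)]
  have "(f' has_derivative frechet_derivative f (at p)) (at p)"
    using has_derivative_transform_within_open[OF d assms(1,2)] assms(4) by simp
  with d assms(5) show ?thesis by (simp add: euclidean_derivative_eq)
qed

section \<open>Uniqueness of the Levi-Civita connection\<close>

text \<open>The difference of two Levi-Civita connections is symmetric in its two arguments and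
  skew with respect to \<open>g\<close>; the three-fold permutation argument then kills it.\<close>

lemma levi_civita_connection_unique:
  assumes LC: "levi_civita_connection U g D" "levi_civita_connection U g D'"
    and M: "semi_riemannian_manifold U g"
    and XY: "smooth_on U X" "smooth_on U Y" and p: "p \<in> U"
  shows "D X Y p = D' X Y p"
proof -
  define T where "T X Y = D X Y p - D' X Y p" for X Y
  have bil: "bilinear (g p)" and symg: "g p v w = g p w v" for v w
    using M p by (auto simp: semi_riemannian_manifold_def)
  have T_sym: "T X Y = T Y X" if "smooth_on U X" "smooth_on U Y" for X Y
  proof -
    have "lie_bracket X Y p = D X Y p - D Y X p" "lie_bracket X Y p = D' X Y p - D' Y X p"
      using LC that p unfolding levi_civita_connection_def by blast+
    then show ?thesis by (simp add: T_def algebra_simps)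
  qed
  have T_skew: "g p (T X Y) (Z p) = - g p (T X Z) (Y p)"
    if "smooth_on U X" "smooth_on U Y" "smooth_on U Z" for X Y Z
  proof -
    have "euclidean_derivative X (\<lambda>q. g q (Y q) (Z q)) p = g p (D X Y p) (Z p) + g p (Y p) (D X Z p)"
      "euclidean_derivative X (\<lambda>q. g q (Y q) (Z q)) p = g p (D' X Y p) (Z p) + g p (Y p) (D' X Z p)"
      using LC that p unfolding levi_civita_connection_def by blast+
    then show ?thesis
      by (simp add: T_def bilinear_lsub[OF bil] symg[of "Y p"])
  qed
  have "g p (T X Y) w = 0" for w
  proof -
    \<comment> \<open>Nondegeneracy tests against single vectors, whereas the identities above
      concern smooth fields; a constant field bridges the two.\<close>
    define Z where "Z = (\<lambda>_::'a. w)"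
    have Z: "smooth_on U Z" "w = Z p" by (simp_all add: Z_def smooth_on_const)
    have "g p (T X Y) (Z p) = - g p (T Z X) (Y p)"
      using T_skew[OF XY Z(1)] T_sym[OF XY(1) Z(1)] by simp
    also have "\<dots> = g p (T Y Z) (X p)"
      using T_skew[OF Z(1) XY] T_sym[OF Z(1) XY(2)] by simp
    also have "\<dots> = - g p (T X Y) (Z p)"
      using T_skew[OF XY(2) Z(1) XY(1)] T_sym[OF XY] by simp
    finally show ?thesis using Z(2) by simp
  qed
  moreover have "\<forall>v. (\<forall>w. g p v w = 0) \<longrightarrow> v = 0"
    using M p by (simp add: semi_riemannian_manifold_def)
  ultimately have "T X Y = 0" by blast
  then show ?thesis by (simp add: T_def)
qed

section \<open>Matrix multiplication and inversion\<close>

lemma bounded_bilinear_matrix_mult: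
  "bounded_bilinear ((**) :: real^'n^'m \<Rightarrow> real^'p^'n \<Rightarrow> real^'p^'m)"
  unfolding bilinear_conv_bounded_bilinear[symmetric] bilinear_def linear_iff
  by (auto simp: matrix_matrix_mult_def vec_eq_iff sum.distrib sum_distrib_left algebra_simps)

text \<open>\<open>**\<close> is not the ring product of its type, so the product rule, the norm
  bound and distributivity are drawn from its bilinearity.\<close>

interpretation matmul: bounded_bilinear "(**) :: real^'n^'n \<Rightarrow> real^'n^'n \<Rightarrow> real^'n^'n"
  by (rule bounded_bilinear_matrix_mult)

lemmas matmul_distribs = matmul.add_left matmul.add_right matmul.diff_left matmul.diff_right
  matmul.minus_left matmul.minus_right matmul.scaleR_left matmul.scaleR_right

lemma linear_trace: "linear (trace :: real^'n^'n \<Rightarrow> real)"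
  by (simp add: linear_iff trace_def sum.distrib sum_distrib_left)

lemmas bounded_linear_trace = linear_trace[THEN linear_conv_bounded_linear[THEN iffD1]]

lemma trace_minus: "trace (- A) = - trace (A :: real^'n^'n)"
  and trace_scaleR: "trace (r *\<^sub>R A) = r * trace A"
  using linear_neg[OF linear_trace] linear_cmul[OF linear_trace] by auto

text \<open>The last two facts are cancellation rules for products associated to the left, the
  normal form produced by \<open>matrix_mul_assoc\<close>.\<close>

lemma GL_matrix_inv:
  assumes "A \<in> GL"
  shows "A ** matrix_inv A = mat 1" "matrix_inv A ** A = mat 1"
    "B ** A ** matrix_inv A = B" "B ** matrix_inv A ** A = B"
proof -
  have "\<exists>A'. A ** A' = mat 1 \<and> A' ** A = mat 1"
    using assms by (simp add: GL_def invertible_def)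
  from someI_ex[OF this] show 1: "A ** matrix_inv A = mat 1" "matrix_inv A ** A = mat 1"
    by (auto simp: matrix_inv_def)
  show "B ** A ** matrix_inv A = B" "B ** matrix_inv A ** A = B"
    by (simp_all add: 1 matrix_mul_assoc[symmetric])
qed

lemma matrix_inv_in_GL: "A \<in> GL \<Longrightarrow> matrix_inv A \<in> GL"
  using GL_matrix_inv(1,2)[of A] by (auto simp: GL_def invertible_def)

text \<open>A one-sided inverse of a square matrix is two-sided, so a single product equal to
  \<open>mat 1\<close> certifies membership in \<open>GL\<close>.\<close>

lemma matrix_inv_unique: 
  assumes "A ** B = mat 1" 
  shows "(A::real^'n^'n) \<in> GL" "matrix_inv A = B"
proof -
  show "A \<in> GL" using assms by (auto simp: GL_def invertible_right_inverse)
  from GL_matrix_inv(2)[OF this] assms show "matrix_inv A = B"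
    by (metis matrix_mul_assoc matrix_mul_lid matrix_mul_rid)
qed

section \<open>Openness of the general linear group and smoothness of inversion\<close>

lemma continuous_on_det:
  fixes f :: "'a::topological_space \<Rightarrow> real^'n^'n"
  assumes "\<And>i j. continuous_on S (\<lambda>x. f x $ i $ j)"
  shows "continuous_on S (\<lambda>x. det (f x))"
  unfolding det_def
  by (intro continuous_on_sum continuous_on_mult continuous_on_const continuous_on_prod assms)

lemma GL_eq_det: "GL = {A :: real^'n^'n. det A \<noteq> 0}"
  by (simp add: GL_def invertible_det_nz)

lemma open_GL: "open (GL :: (real^'n^'n) set)"
proof -
  have "continuous_on UNIV (\<lambda>A :: real^'n^'n. det A)"
    by (intro continuous_on_det continuous_intros)
  then show ?thesis
    unfolding GL_eq_det by (intro open_Collect_neq continuous_on_const)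
qed

text \<open>Continuity of the inverse is read off Cramer's rule.\<close>

lemma continuous_on_matrix_inv: "continuous_on (GL :: (real^'n^'n) set) matrix_inv"
proof -
  \<comment> \<open>Column \<open>j\<close> of the inverse solves \<open>A *v x = axis j 1\<close>;
    Cramer's rule writes its entries as quotients of determinants.\<close>
  have eq: "matrix_inv A = (\<chi> k j. det (\<chi> i l. if l = k then (axis j 1) $ i else A $ i $ l) / det A)"
    if "A \<in> GL" for A :: "real^'n^'n"
  proof -
    have "A *v (matrix_inv A *v axis j 1) = axis j 1" for j
      by (simp add: matrix_vector_mul_assoc GL_matrix_inv(1)[OF that])
    then have "matrix_inv A *v axis j 1 = (\<chi> k. det (\<chi> i l. if l = k then (axis j 1) $ i else A $ i $ l) / det A)" for j
      using that cramer[of A] unfolding GL_eq_det by blast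
    then have "(matrix_inv A *v axis j 1) $ k = det (\<chi> i l. if l = k then (axis j 1) $ i else A $ i $ l) / det A" for j k
      by simp
    then show ?thesis
      by (simp add: vec_eq_iff matrix_vector_mult_basis column_def)
  qed
  have "continuous_on (GL :: (real^'n^'n) set)
     (\<lambda>A. \<chi> k j. det (\<chi> i l. if l = k then (axis j 1) $ i else A $ i $ l) / det A)"
  proof (intro continuous_on_vec_lambda continuous_on_divide continuous_on_det)
    show "continuous_on GL (\<lambda>A :: real^'n^'n. (\<chi> i l. if l = k then axis j 1 $ i else A $ i $ l) $ i' $ l')" for k j i' l'
      \<comment> \<open>In column \<open>k\<close> the entries are constants, elsewhere they are
        coordinates of \<open>A\<close>.\<close>
      by (cases "l' = k") (simp_all add: continuous_on_component)
  qed (auto simp: GL_eq_det intro!: continuous_intros)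
  then show ?thesis by (simp add: eq cong: continuous_on_cong)
qed

text \<open>For \<open>B\<close> in \<open>GL\<close> the remainder factors exactly as
  \<open>(matrix_inv A - matrix_inv B) ** ((B - A) ** matrix_inv A)\<close>. One factor is of order
  \<open>norm (B - A)\<close> and another tends to \<open>0\<close>, so continuity of inversion
  upgrades to differentiability.\<close>

lemma has_derivative_matrix_inv:
  fixes A :: "real^'n^'n"
  assumes A: "A \<in> GL"
  shows "(matrix_inv has_derivative (\<lambda>V. - (matrix_inv A ** V ** matrix_inv A))) (at A)"
  unfolding has_derivative_iff_norm
proof (intro conjI)
  show "bounded_linear (\<lambda>V. - (matrix_inv A ** V ** matrix_inv A))"
    by (rule linear_conv_bounded_linear[THEN iffD1]) (simp add: linear_iff matmul_distribs)
  obtain K where K: "K > 0" "\<And>(a :: real^'n^'n) (b :: real^'n^'n). norm (a ** b) \<le> norm a * norm b * K"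
    using matmul.pos_bounded[where 'n = 'n] by blast
  \<comment> \<open>The norm bound is applied to both products in the factored remainder, hence two
    factors \<open>K\<close>.\<close>
  define M where "M = norm (matrix_inv A) * K * K"
  have "isCont matrix_inv A"
    using continuous_on_eq_continuous_at[OF open_GL, THEN iffD1, OF continuous_on_matrix_inv] A
    by (rule bspec)
  then have "((\<lambda>B. matrix_inv A - matrix_inv B) \<longlongrightarrow> matrix_inv A - matrix_inv A) (at A)"
    unfolding isCont_def by (rule tendsto_diff[OF tendsto_const])
  then have "((\<lambda>B. norm (matrix_inv A - matrix_inv B) * M) \<longlongrightarrow> norm (matrix_inv A - matrix_inv A) * M) (at A)"
    by (rule tendsto_mult[OF tendsto_norm tendsto_const])
  then have lim: "((\<lambda>B. norm (matrix_inv A - matrix_inv B) * M) \<longlongrightarrow> 0) (at A)" by simp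
  have ev: "eventually (\<lambda>B. B \<in> GL) (at A)"
    using eventually_at_in_open'[OF open_GL A] .
  show "((\<lambda>B. norm (matrix_inv B - matrix_inv A - - (matrix_inv A ** (B - A) ** matrix_inv A)) / norm (B - A)) \<longlongrightarrow> 0) (at A)"
  proof (rule tendsto_sandwich[OF _ _ tendsto_const lim])
    show "\<forall>\<^sub>F B in at A. norm (matrix_inv B - matrix_inv A - - (matrix_inv A ** (B - A) ** matrix_inv A)) / norm (B - A)
        \<le> norm (matrix_inv A - matrix_inv B) * M"
      using ev
    proof eventually_elim
      case (elim B)
      have "matrix_inv B - matrix_inv A - - (matrix_inv A ** (B - A) ** matrix_inv A)
        = (matrix_inv A - matrix_inv B) ** ((B - A) ** matrix_inv A)"
        by (simp add: matmul_distribs matrix_mul_assoc GL_matrix_inv[OF A] GL_matrix_inv[OF elim])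
      then have "norm (matrix_inv B - matrix_inv A - - (matrix_inv A ** (B - A) ** matrix_inv A))
        \<le> norm (matrix_inv A - matrix_inv B) * norm ((B - A) ** matrix_inv A) * K"
        using K(2) by metis
      also have "\<dots> \<le> norm (matrix_inv A - matrix_inv B) * (norm (B - A) * norm (matrix_inv A) * K) * K"
        using K by (intro mult_right_mono mult_left_mono) auto
      also have "\<dots> = (norm (matrix_inv A - matrix_inv B) * M) * norm (B - A)"
        by (simp add: M_def)
      \<comment> \<open>Only \<open>B \<in> GL\<close> is known here, so \<open>B = A\<close> has to
        be treated; there division by \<open>0\<close> yields \<open>0\<close>.\<close>
      finally show ?case
        using K(1) by (cases "B = A") (simp_all add: divide_le_eq M_def)
    qed
  qed auto
qed

text \<open>The derivative of inversion is built from inversion by products, so class C^k of the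
  inverse yields class C^(k+1).\<close>

lemma smooth_on_matrix_inv: "smooth_on (GL :: (real^'n^'n) set) matrix_inv"
proof -
  have "Ck_on k (GL :: (real^'n^'n) set) matrix_inv" for k
  proof (induction k)
    case 0
    then show ?case by (simp add: continuous_on_matrix_inv)
  next
    case (Suc k)
    show ?case
      by (rule Ck_on_SucI[OF open_GL has_derivative_matrix_inv])
        (auto intro!: Ck_on_linear[OF open_GL, of uminus] Ck_on_bilinear[OF open_GL bounded_bilinear_matrix_mult]
          Suc Ck_on_const module_hom_uminus)
  qed
  then show ?thesis by (simp add: smooth_on_def)
qed

section \<open>The trace metric\<close>

lemma trace_metric_sym: "trace_metric A V W = trace_metric A W V"
  unfolding trace_metric_def
  using trace_mul_sym[of "matrix_inv A ** V" "matrix_inv A ** W"] by (simp add: matrix_mul_assoc)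

lemma bilinear_trace_metric: "bilinear (trace_metric A)"
  by (simp add: bilinear_def linear_iff trace_metric_def matmul_distribs trace_add trace_scaleR)

lemma smooth_on_trace_metric:
  assumes "smooth_on GL X" "smooth_on GL Y"
  shows "smooth_on GL (\<lambda>A. trace_metric A (X A) (Y A))"
  unfolding trace_metric_def
  by (intro smooth_on_linear[OF open_GL linear_trace] smooth_on_bilinear[OF open_GL bounded_bilinear_matrix_mult]
      smooth_on_matrix_inv assms)

text \<open>This trace is the sum of the squares of all entries of \<open>M\<close>.\<close>

lemma trace_mult_transpose_eq_0:
  fixes M :: "real^'n^'m"
  assumes "trace (M ** transpose M) = 0"
  shows "M = 0"
proof -
  have "(\<Sum>i\<in>UNIV. \<Sum>j\<in>UNIV. (M $ i $ j)^2) = 0"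
    using assms by (simp add: trace_def matrix_matrix_mult_def transpose_def power2_eq_square)
  then have "(M $ i $ j)^2 = 0" for i j
    by (simp add: sum_nonneg_eq_0_iff sum_nonneg)
  then show ?thesis by (simp add: vec_eq_iff)
qed

lemma trace_metric_nondegenerate:
  assumes "A \<in> GL" "\<And>W. trace_metric A V W = 0"
  shows "V = 0"
proof -
  \<comment> \<open>The chosen \<open>W\<close> turns the pairing into
    \<open>trace (M ** transpose M)\<close> with \<open>M = matrix_inv A ** V\<close>.\<close>
  have "matrix_inv A ** V = 0"
    using assms(2)[of "A ** transpose (matrix_inv A ** V)"]
    by (intro trace_mult_transpose_eq_0) (simp add: trace_metric_def matrix_mul_assoc GL_matrix_inv[OF assms(1)])
  then have "A ** (matrix_inv A ** V) = 0" by simp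
  then show ?thesis by (simp add: matrix_mul_assoc GL_matrix_inv[OF assms(1)])
qed

text \<open>\<open>T\<close> maps a negative definite subspace for \<open>B'\<close> to one for
  \<open>B\<close> of the same dimension. Comparing the sets of dimensions before taking
  \<open>Max\<close> lets two opposite inclusions give equality of the indices.\<close>

lemma form_index_dims_mono:
  fixes T :: "'a::euclidean_space \<Rightarrow> 'b::euclidean_space"
  assumes "linear T" "inj T" "\<And>v. B (T v) (T v) = B' v v"
  shows "{dim S |S. subspace S \<and> (\<forall>v\<in>S. v \<noteq> 0 \<longrightarrow> B' v v < 0)}
    \<subseteq> {dim S |S. subspace S \<and> (\<forall>v\<in>S. v \<noteq> 0 \<longrightarrow> B v v < 0)}"
proof safe
  fix S :: "'a set" assume S: "subspace S" "\<forall>v\<in>S. v \<noteq> 0 \<longrightarrow> B' v v < 0"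
  have "dim (T ` S) = dim S"
    using assms by (intro dim_image_eq) (auto intro: inj_on_subset)
  moreover have "subspace (T ` S)" by (rule linear_subspace_image[OF assms(1) S(1)])
  moreover have "\<forall>v\<in>T ` S. v \<noteq> 0 \<longrightarrow> B v v < 0"
    using S(2) assms(3) linear_0[OF assms(1)] by (metis imageE)
  ultimately show "\<exists>S'. dim S = dim S' \<and> subspace S' \<and> (\<forall>v\<in>S'. v \<noteq> 0 \<longrightarrow> B v v < 0)"
    by metis
qed

lemma form_index_trace_metric:
  fixes A :: "real^'n^'n"
  assumes A: "A \<in> GL"
  shows "form_index (trace_metric A) = form_index (trace_metric (mat 1 :: real^'n^'n))"
proof -
  have inv1: "matrix_inv (mat 1 :: real^'n^'n) = mat 1"
    by (rule matrix_inv_unique) simp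
  have inj: "inj ((**) B)" if "B \<in> GL" for B :: "real^'n^'n"
    by (rule inj_on_inverseI[of _ "(**) (matrix_inv B)"]) (simp add: matrix_mul_assoc GL_matrix_inv[OF that])
  \<comment> \<open>Multiplication by \<open>matrix_inv A\<close> carries the form at
    \<open>A\<close> to the form at the identity, and multiplication by \<open>A\<close> goes back;
    each gives one inclusion.\<close>
  show ?thesis
    unfolding form_index_def
    by (rule arg_cong[of _ _ Max], rule equalityI[OF
      form_index_dims_mono[OF _ inj[OF matrix_inv_in_GL[OF A]]] form_index_dims_mono[OF _ inj[OF A]]])
      (simp_all add: linear_iff matmul_distribs trace_metric_def inv1 matrix_mul_assoc GL_matrix_inv[OF A])
qed

lemma semi_riemannian_manifold_GL: "semi_riemannian_manifold (GL :: (real^'n^'n) set) trace_metric"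
  unfolding semi_riemannian_manifold_def
proof (intro conjI exI[of _ "form_index (trace_metric (mat 1 :: real^'n^'n))"] ballI allI impI)
  show "smooth_on GL (\<lambda>A. trace_metric A V W)" for V W :: "real^'n^'n"
    by (rule smooth_on_trace_metric[OF smooth_on_const smooth_on_const])
  show "V = 0" if "A \<in> GL" "\<forall>W. trace_metric A V W = 0" for A V :: "real^'n^'n"
    using that trace_metric_nondegenerate by blast
qed (simp_all add: open_GL bilinear_trace_metric trace_metric_sym form_index_trace_metric)

section \<open>The Levi-Civita connection of the trace metric\<close>

definition trace_connection ::
    "(real^'n^'n \<Rightarrow> real^'n^'n) \<Rightarrow> (real^'n^'n \<Rightarrow> real^'n^'n) \<Rightarrow> real^'n^'n \<Rightarrow> real^'n^'n" where
  "trace_connection X Y P = euclidean_derivative X Y P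
     - (1/2) *\<^sub>R (X P ** matrix_inv P ** Y P + Y P ** matrix_inv P ** X P)"

text \<open>In the product rule the terms that differentiate \<open>Y\<close> and \<open>Z\<close>
  match directly. The two terms that differentiate an inverse have to match the four half terms
  contributed by the corrections.\<close>

lemma trace_connection_metric:
  fixes X Y Z :: "real^'n^'n \<Rightarrow> real^'n^'n"
  assumes "smooth_on GL Y" "smooth_on GL Z" and P: "P \<in> GL"
  shows "euclidean_derivative X (\<lambda>Q. trace_metric Q (Y Q) (Z Q)) P
    = trace_metric P (trace_connection X Y P) (Z P) + trace_metric P (Y P) (trace_connection X Z P)"
proof -
  define Y' Z' where "Y' = frechet_derivative Y (at P)" and "Z' = frechet_derivative Z (at P)"
  note dY = smooth_on_has_derivative[OF assms(1) P, folded Y'_def]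
    and dZ = smooth_on_has_derivative[OF assms(2) P, folded Z'_def]
  define i y z x y' z' where "i = matrix_inv P" and "y = Y P" and "z = Z P" and "x = X P"
    and "y' = Y' (X P)" and "z' = Z' (X P)"
  note defs = i_def y_def z_def x_def y'_def z'_def
  have "euclidean_derivative X (\<lambda>Q. trace_metric Q (Y Q) (Z Q)) P
    = trace (i ** y ** i ** z' + (i ** y ** (- (i ** x ** i)) + (i ** y' + (- (i ** x ** i)) ** y) ** i) ** z)"
    unfolding trace_metric_def defs
    by (rule euclidean_derivative_eq[OF bounded_linear.has_derivative[OF bounded_linear_trace
          matmul.FDERIV[OF matmul.FDERIV[OF matmul.FDERIV[OF has_derivative_matrix_inv[OF P] dY]
            has_derivative_matrix_inv[OF P]] dZ]]])
  moreover have "trace_connection X Y P = y' - (1/2) *\<^sub>R (x ** i ** y + y ** i ** x)"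
    "trace_connection X Z P = z' - (1/2) *\<^sub>R (x ** i ** z + z ** i ** x)"
    by (simp_all add: trace_connection_def defs euclidean_derivative_eq[OF dY] euclidean_derivative_eq[OF dZ])
  \<comment> \<open>Two of the four half terms coincide as they stand; this cyclic rotation
    identifies the other two.\<close>
  moreover have "trace (i ** y ** i ** z ** i ** x) = trace (i ** x ** i ** y ** i ** z)"
    using trace_mul_sym[of "i ** y ** i ** z" "i ** x"] by (simp add: matrix_mul_assoc)
  ultimately show ?thesis
    by (simp add: trace_metric_def matmul_distribs matrix_mul_assoc trace_add trace_sub trace_minus trace_scaleR
        flip: i_def y_def z_def) (simp add: field_simps)
qed

text \<open>The correction is bilinear over functions, so the derivative term in the Leibniz rule
  comes from \<open>euclidean_derivative\<close> alone.\<close>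

lemma connection_on_trace_connection: "connection_on (GL :: (real^'n^'n) set) trace_connection"
  unfolding connection_on_def
proof (intro conjI allI impI ballI)
  fix X Y :: "real^'n^'n \<Rightarrow> real^'n^'n"
  assume "smooth_on GL X" "smooth_on GL Y"
  then show "smooth_on GL (trace_connection X Y)"
    unfolding trace_connection_def[abs_def]
    by (intro smooth_on_diff smooth_on_euclidean_derivative open_GL smooth_on_add
        smooth_on_bilinear[OF open_GL bounded_bilinear_scaleR] smooth_on_const
        smooth_on_bilinear[OF open_GL bounded_bilinear_matrix_mult] smooth_on_matrix_inv)
next
  fix X X' Y Y' :: "real^'n^'n \<Rightarrow> real^'n^'n" and P :: "real^'n^'n"
  assume "smooth_on GL Y" "\<forall>p\<in>GL. X' p = X p \<and> Y' p = Y p" "P \<in> GL"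
  then show "trace_connection X' Y' P = trace_connection X Y P"
    using euclidean_derivative_cong[OF open_GL \<open>P \<in> GL\<close> \<open>smooth_on GL Y\<close>, of Y' X' X]
    by (simp add: trace_connection_def)
next
  fix X X' Y :: "real^'n^'n \<Rightarrow> real^'n^'n" and P :: "real^'n^'n"
  assume Y: "smooth_on GL Y" and P: "P \<in> GL"
  note dY = smooth_on_has_derivative[OF Y P]
  show "trace_connection (\<lambda>q. X q + X' q) Y P = trace_connection X Y P + trace_connection X' Y P"
    by (simp add: trace_connection_def euclidean_derivative_eq[OF dY] matmul_distribs
        linear_add[OF has_derivative_linear[OF dY]] algebra_simps)
next
  fix X Y :: "real^'n^'n \<Rightarrow> real^'n^'n" and f :: "real^'n^'n \<Rightarrow> real" and P :: "real^'n^'n"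
  assume Y: "smooth_on GL Y" and P: "P \<in> GL"
  note dY = smooth_on_has_derivative[OF Y P]
  show "trace_connection (\<lambda>q. f q *\<^sub>R X q) Y P = f P *\<^sub>R trace_connection X Y P"
    by (simp add: trace_connection_def euclidean_derivative_eq[OF dY] matmul_distribs
        linear_cmul[OF has_derivative_linear[OF dY]] algebra_simps)
next
  fix X Y Y' :: "real^'n^'n \<Rightarrow> real^'n^'n" and P :: "real^'n^'n"
  assume Y: "smooth_on GL Y" "smooth_on GL Y'" and P: "P \<in> GL"
  note dY = smooth_on_has_derivative[OF Y(1) P] smooth_on_has_derivative[OF Y(2) P]
  show "trace_connection X (\<lambda>q. Y q + Y' q) P = trace_connection X Y P + trace_connection X Y' P"
    unfolding trace_connection_def euclidean_derivative_eq[OF has_derivative_add[OF dY]]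
      euclidean_derivative_eq[OF dY(1)] euclidean_derivative_eq[OF dY(2)]
    by (simp add: matmul_distribs algebra_simps)
next
  fix X Y :: "real^'n^'n \<Rightarrow> real^'n^'n" and c :: real and P :: "real^'n^'n"
  assume Y: "smooth_on GL Y" and P: "P \<in> GL"
  note dY = smooth_on_has_derivative[OF Y P]
  show "trace_connection X (\<lambda>q. c *\<^sub>R Y q) P = c *\<^sub>R trace_connection X Y P"
    by (simp add: trace_connection_def euclidean_derivative_eq[OF dY]
        euclidean_derivative_eq[OF has_derivative_scaleR_right[OF dY]] matmul_distribs algebra_simps)
next
  fix X Y :: "real^'n^'n \<Rightarrow> real^'n^'n" and f :: "real^'n^'n \<Rightarrow> real" and P :: "real^'n^'n"
  assume f: "smooth_on GL f" and Y: "smooth_on GL Y" and P: "P \<in> GL"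
  note df = smooth_on_has_derivative[OF f P] and dY = smooth_on_has_derivative[OF Y P]
  show "trace_connection X (\<lambda>q. f q *\<^sub>R Y q) P
      = euclidean_derivative X f P *\<^sub>R Y P + f P *\<^sub>R trace_connection X Y P"
    by (simp add: trace_connection_def euclidean_derivative_eq[OF dY] euclidean_derivative_eq[OF df]
        euclidean_derivative_eq[OF has_derivative_scaleR[OF df dY]] matmul_distribs algebra_simps)
qed

text \<open>The correction is symmetric in the two fields and cancels in the torsion, leaving the
  difference of euclidean derivatives that defines \<open>lie_bracket\<close>.\<close>

lemma levi_civita_connection_trace_connection:
  "levi_civita_connection (GL :: (real^'n^'n) set) trace_metric trace_connection"
  unfolding levi_civita_connection_def
  using connection_on_trace_connection
  by (simp add: trace_connection_metric) (simp add: lie_bracket_def trace_connection_def algebra_simps)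

text \<open>\<open>levi_civita\<close> is a \<open>SOME\<close> choice.
  \<open>trace_connection\<close> witnesses that the predicate is satisfiable, and uniqueness then
  pins down the chosen operator on smooth fields over \<open>GL\<close>.\<close>

lemma levi_civita_GL:
  fixes X Y :: "real^'n^'n \<Rightarrow> real^'n^'n"
  assumes "smooth_on GL X" "smooth_on GL Y" "P \<in> GL"
  shows "levi_civita GL trace_metric X Y P = trace_connection X Y P"
proof -
  have "levi_civita_connection (GL :: (real^'n^'n) set) trace_metric (levi_civita GL trace_metric)"
    unfolding levi_civita_def by (rule someI[of "levi_civita_connection GL trace_metric", OF levi_civita_connection_trace_connection])
  from levi_civita_connection_unique[OF this levi_civita_connection_trace_connection
      semi_riemannian_manifold_GL assms] show ?thesis .
qed

section \<open>The induced covariant derivative along curves and the geodesic equation\<close>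

lemma cov_deriv_along_GL:
  fixes c V :: "real \<Rightarrow> real^'n^'n"
  assumes "c t \<in> GL"
  shows "cov_deriv_along (levi_civita GL trace_metric) c V t = velocity V t
    - (1/2) *\<^sub>R (velocity c t ** matrix_inv (c t) ** V t + V t ** matrix_inv (c t) ** velocity c t)"
proof -
  \<comment> \<open>Constant fields have zero euclidean derivative, so the Christoffel terms are the
    values of this bilinear \<open>B\<close> on basis pairs; bilinearity then reassembles the
    coordinate sum.\<close>
  define B where "B x y = - ((1/2) *\<^sub>R (x ** matrix_inv (c t) ** y + y ** matrix_inv (c t) ** x))" for x y
  have bil: "bilinear B"
    by (simp add: bilinear_def linear_iff B_def matmul_distribs algebra_simps)
  have "levi_civita GL trace_metric (\<lambda>_. i) (\<lambda>_. j) (c t) = B i j" for i j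
    by (simp add: levi_civita_GL[OF smooth_on_const smooth_on_const assms] trace_connection_def B_def
        euclidean_derivative_eq[OF has_derivative_const])
  then have "cov_deriv_along (levi_civita GL trace_metric) c V t
    = velocity V t + (\<Sum>i\<in>Basis. \<Sum>j\<in>Basis. B ((velocity c t \<bullet> i) *\<^sub>R i) ((V t \<bullet> j) *\<^sub>R j))"
    by (simp add: cov_deriv_along_def bilinear_lmul[OF bil] bilinear_rmul[OF bil] mult.commute)
  also have "\<dots> = velocity V t + B (\<Sum>i\<in>Basis. (velocity c t \<bullet> i) *\<^sub>R i) (\<Sum>j\<in>Basis. (V t \<bullet> j) *\<^sub>R j)"
    by (simp only: bilinear_sum[OF bil] sum.cartesian_product)
  finally show ?thesis by (simp only: euclidean_representation) (simp add: B_def)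
qed

text \<open>With \<open>V\<close> equal to the velocity the two half terms coincide and the factor
  \<open>1/2\<close> disappears.\<close>

lemma cov_deriv_along_velocity_GL:
  fixes c :: "real \<Rightarrow> real^'n^'n"
  assumes "c t \<in> GL"
  shows "cov_deriv_along (levi_civita GL trace_metric) c (velocity c) t
    = velocity (velocity c) t - velocity c t ** matrix_inv (c t) ** velocity c t"
  unfolding cov_deriv_along_GL[of c t, OF assms] scaleR_half_double by simp

lemma geodesic_GL_iff:
  fixes c :: "real \<Rightarrow> real^'n^'n"
  shows "geodesic GL trace_metric I c \<longleftrightarrow> smooth_curve GL I c \<and>
    (\<forall>t\<in>I. velocity (velocity c) t - velocity c t ** matrix_inv (c t) ** velocity c t = 0)"
  unfolding geodesic_def smooth_curve_def using cov_deriv_along_velocity_GL[of c] by auto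

section \<open>The matrix exponential\<close>

text \<open>Geometric growth of the powers, with ratio \<open>norm A * K\<close>, makes the
  exponential series comparable with a scalar one.\<close>

lemma norm_funpow_matrix_mult:
  fixes A :: "real^'n^'n"
  obtains M where "\<And>k. norm ((((**) A) ^^ k) (mat 1 :: real^'n^'n)) \<le> norm (mat 1 :: real^'n^'n) * M ^ k"
proof -
  obtain K where K: "K > 0" "\<And>(a :: real^'n^'n) (b :: real^'n^'n). norm (a ** b) \<le> norm a * norm b * K"
    using matmul.pos_bounded[where 'n = 'n] by blast
  have "norm ((((**) A) ^^ k) (mat 1 :: real^'n^'n)) \<le> norm (mat 1 :: real^'n^'n) * (norm A * K) ^ k" for k
  proof (induction k)
    case (Suc k)
    have "norm ((((**) A) ^^ Suc k) (mat 1 :: real^'n^'n))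
      \<le> norm A * norm ((((**) A) ^^ k) (mat 1 :: real^'n^'n)) * K"
      using K(2) by simp
    also have "\<dots> \<le> norm A * (norm (mat 1 :: real^'n^'n) * (norm A * K) ^ k) * K"
      using K(1) Suc by (intro mult_left_mono mult_right_mono) auto
    finally show ?case by (simp add: mult_ac)
  qed simp
  then show ?thesis by (rule that)
qed

lemma summable_matrix_exp:
  fixes A :: "real^'n^'n"
  shows "summable (\<lambda>k. (1 / fact k) *\<^sub>R (((**) A) ^^ k) (mat 1 :: real^'n^'n))"
proof -
  obtain M where M: "\<And>k. norm ((((**) A) ^^ k) (mat 1 :: real^'n^'n)) \<le> norm (mat 1 :: real^'n^'n) * M ^ k"
    using norm_funpow_matrix_mult[of A] by blast
  show ?thesis
  proof (rule summable_comparison_test')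
    show "summable (\<lambda>k. norm (mat 1 :: real^'n^'n) * (inverse (fact k) * M ^ k))"
      by (intro summable_mult summable_exp)
    show "norm ((1 / fact k) *\<^sub>R (((**) A) ^^ k) (mat 1 :: real^'n^'n))
      \<le> norm (mat 1 :: real^'n^'n) * (inverse (fact k) * M ^ k)" for k
      using M[of k] by (simp add: field_simps)
  qed
qed

text \<open>A linear map on matrices is bounded and so passes through the series. It is applied to
  single entries and to multiplication by a fixed matrix on either side.\<close>

lemma linear_matrix_exp_sums:
  fixes L :: "real^'n^'n \<Rightarrow> 'b::real_normed_vector"
  assumes "linear L"
  shows "(\<lambda>k. (1 / fact k) *\<^sub>R L ((((**) A) ^^ k) (mat 1))) sums L (matrix_exp A)"
  using bounded_linear.sums[OF assms[THEN linear_conv_bounded_linear[THEN iffD1]]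
      summable_sums[OF summable_matrix_exp[of A]]]
  by (simp add: matrix_exp_def linear_cmul[OF assms])

lemma funpow_matrix_mult_scaleR:
  fixes A :: "real^'n^'n"
  shows "(((**) (t *\<^sub>R A)) ^^ k) (mat 1 :: real^'n^'n) = t ^ k *\<^sub>R (((**) A) ^^ k) (mat 1)"
  by (induction k) (simp_all add: matmul_distribs)

lemma matrix_exp_0: "matrix_exp 0 = (mat 1 :: real^'n^'n)"
proof -
  have "(((**) (0 :: real^'n^'n)) ^^ k) (mat 1) = 0" if "k \<noteq> 0" for k
    using that by (cases k) (simp_all add: matmul.zero_left)
  then have "matrix_exp (0 :: real^'n^'n) = (\<Sum>k\<in>{0}. (1 / fact k) *\<^sub>R (((**) (0 :: real^'n^'n)) ^^ k) (mat 1))"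
    unfolding matrix_exp_def by (intro suminf_finite) auto
  then show ?thesis by simp
qed

lemma linear_matrix_mult_left: "linear (\<lambda>B. A ** B :: real^'n^'n)"
  and linear_matrix_mult_right: "linear (\<lambda>B. B ** A :: real^'n^'n)"
  for A :: "real^'n^'n"
  by (simp_all add: linear_iff matmul_distribs)

text \<open>Powers of \<open>A\<close> commute with \<open>A\<close>, so left and right
  multiplication by \<open>A\<close> produce the same series term by term.\<close>

lemma matrix_exp_commute: "matrix_exp (t *\<^sub>R A) ** A = A ** matrix_exp (t *\<^sub>R A)"
  for A :: "real^'n^'n"
proof -
  have "(((**) A) ^^ k) (mat 1) ** A = A ** (((**) A) ^^ k) (mat 1)" for k
    by (induction k) (simp_all add: matrix_mul_assoc[symmetric])
  then show ?thesis
    using linear_matrix_exp_sums[OF linear_matrix_mult_left[of A], of "t *\<^sub>R A"]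
      linear_matrix_exp_sums[OF linear_matrix_mult_right[of A], of "t *\<^sub>R A"]
    by (simp add: funpow_matrix_mult_scaleR matmul_distribs sums_iff)
qed

text \<open>Entrywise, \<open>t \<mapsto> exp (t C)\<close> is an everywhere convergent real power series.\<close>

lemma has_vector_derivative_matrix_exp:
  fixes C :: "real^'n^'n"
  shows "((\<lambda>t. matrix_exp (t *\<^sub>R C)) has_vector_derivative C ** matrix_exp (t *\<^sub>R C)) (at t)"
proof -
  have entry: "((\<lambda>t. matrix_exp (t *\<^sub>R C) $ i $ j) has_real_derivative (C ** matrix_exp (t *\<^sub>R C)) $ i $ j) (at t)" for i j
  proof -
    define c where "c k = (((**) C) ^^ k) (mat 1) $ i $ j / fact k" for k
    have "linear (\<lambda>A :: real^'n^'n. A $ i $ j)" "linear (\<lambda>A :: real^'n^'n. (C ** A) $ i $ j)"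
      by (simp_all add: linear_iff matmul_distribs)
    note sums = this[THEN linear_matrix_exp_sums]
    have c: "(\<lambda>k. c k * s ^ k) sums (matrix_exp (s *\<^sub>R C) $ i $ j)" for s
      using sums(1)[of "s *\<^sub>R C"] by (simp add: c_def funpow_matrix_mult_scaleR mult_ac)
    \<comment> \<open>The factor \<open>k + 1\<close> of the formal derivative reduces
      \<open>fact (Suc k)\<close> to \<open>fact k\<close>, while the power \<open>Suc k\<close>
      supplies the extra \<open>C\<close>.\<close>
    have "diffs c k = (C ** (((**) C) ^^ k) (mat 1)) $ i $ j / fact k" for k
      by (simp add: diffs_def c_def)
    then have "(\<lambda>k. diffs c k * t ^ k) sums ((C ** matrix_exp (t *\<^sub>R C)) $ i $ j)"
      using sums(2)[of "t *\<^sub>R C"] by (simp add: funpow_matrix_mult_scaleR matmul_distribs mult_ac)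
    moreover have "((\<lambda>t. \<Sum>k. c k * t ^ k) has_real_derivative (\<Sum>k. diffs c k * t ^ k)) (at t)"
      using c by (intro termdiffs_strong_converges_everywhere) (auto simp: sums_iff)
    ultimately show ?thesis using c by (simp add: sums_iff)
  qed
  show ?thesis
    unfolding has_vector_derivative_def
    by (subst has_derivative_componentwise_within)
      (use entry[unfolded has_real_derivative_iff_has_vector_derivative has_vector_derivative_def]
        in \<open>auto simp: Basis_vec_def inner_axis\<close>)
qed

section \<open>Invertibility of the exponential\<close>

lemma has_vector_derivative_zero_const:
  fixes f :: "real \<Rightarrow> 'a::real_normed_vector"
  assumes "is_interval I" "\<And>t. t \<in> I \<Longrightarrow> (f has_vector_derivative 0) (at t)"
  obtains c where "\<And>t. t \<in> I \<Longrightarrow> f t = c"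
proof -
  have "\<exists>c. \<forall>x\<in>I. f x = c"
    using assms(2) by (intro has_derivative_zero_constant is_interval_convex assms(1))
      (auto simp: has_vector_derivative_def intro: has_derivative_at_withinI)
  then show ?thesis using that by blast
qed

text \<open>Since \<open>C\<close> commutes with its exponential, the two terms of the product rule
  cancel, and the product keeps its value at time \<open>0\<close>.\<close>

lemma matrix_exp_mult_uminus:
  fixes C :: "real^'n^'n"
  shows "matrix_exp (t *\<^sub>R C) ** matrix_exp (t *\<^sub>R (- C)) = mat 1"
proof -
  have "((\<lambda>t. matrix_exp (t *\<^sub>R C) ** matrix_exp (t *\<^sub>R (- C))) has_vector_derivative 0) (at s)" for s
    using matmul.has_vector_derivative[OF has_vector_derivative_matrix_exp[of C s] has_vector_derivative_matrix_exp[of "- C" s]]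
    by (simp add: matmul_distribs matrix_mul_assoc matrix_exp_commute del: scaleR_minus_right)
  then obtain c where c: "\<And>s. s \<in> UNIV \<Longrightarrow> matrix_exp (s *\<^sub>R C) ** matrix_exp (s *\<^sub>R (- C)) = c"
    using has_vector_derivative_zero_const[OF is_interval_univ] by blast
  from c[of 0] have "c = mat 1" by (simp add: matrix_exp_0)
  with c show ?thesis by simp
qed

lemma matrix_exp_in_GL: "matrix_exp (t *\<^sub>R C) \<in> GL"
  by (rule matrix_inv_unique(1)[OF matrix_exp_mult_uminus])

lemma GL_mult: "A \<in> GL \<Longrightarrow> B \<in> GL \<Longrightarrow> A ** B \<in> GL"
  by (simp add: GL_def invertible_mult)

section \<open>Geodesics\<close>

lemma has_vector_derivative_mult_matrix_exp:
  fixes K C :: "real^'n^'n"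
  shows "((\<lambda>t. K ** matrix_exp (t *\<^sub>R C)) has_vector_derivative (K ** C) ** matrix_exp (t *\<^sub>R C)) (at t)"
  using matmul.has_vector_derivative[OF has_vector_derivative_const has_vector_derivative_matrix_exp]
  by (simp add: matmul.zero_left matrix_mul_assoc)

text \<open>Differentiation only replaces \<open>K\<close> by \<open>K ** C\<close>, so the
  induction runs over all matrices \<open>K\<close>, singular ones included.\<close>

lemma smooth_on_mult_matrix_exp:
  fixes K C :: "real^'n^'n"
  shows "smooth_on UNIV (\<lambda>t. K ** matrix_exp (t *\<^sub>R C))"
proof -
  have "Ck_on k UNIV (\<lambda>t. K ** matrix_exp (t *\<^sub>R C))" for k
  proof (induction k arbitrary: K)
    case 0
    show ?case
      using has_vector_derivative_continuous[OF has_vector_derivative_mult_matrix_exp]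
      by (auto intro!: continuous_at_imp_continuous_on)
  next
    case (Suc k)
    show ?case
    proof (rule Ck_on_SucI[OF open_UNIV])
      show "((\<lambda>t. K ** matrix_exp (t *\<^sub>R C)) has_derivative (\<lambda>v. v *\<^sub>R ((K ** C) ** matrix_exp (t *\<^sub>R C)))) (at t)" for t
        using has_vector_derivative_mult_matrix_exp by (simp add: has_vector_derivative_def)
      show "Ck_on k UNIV (\<lambda>t. v *\<^sub>R ((K ** C) ** matrix_exp (t *\<^sub>R C)))" for v
        by (rule Ck_on_bilinear[OF open_UNIV bounded_bilinear_scaleR Ck_on_const Suc])
    qed
  qed
  then show ?thesis by (simp add: smooth_on_def)
qed

lemma velocity_mult_matrix_exp:
  "velocity (\<lambda>t. K ** matrix_exp (t *\<^sub>R C)) = (\<lambda>t. (K ** C) ** matrix_exp (t *\<^sub>R C))"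
  for K C :: "real^'n^'n"
  unfolding velocity_def by (intro ext vector_derivative_at has_vector_derivative_mult_matrix_exp)

lemma geodesic_mult_matrix_exp:
  fixes K C :: "real^'n^'n"
  assumes "K \<in> GL"
  shows "geodesic GL trace_metric UNIV (\<lambda>t. K ** matrix_exp (t *\<^sub>R C))"
proof -
  define c where "c t = K ** matrix_exp (t *\<^sub>R C)" for t
  have GL: "c t \<in> GL" for t
    unfolding c_def by (rule GL_mult[OF assms matrix_exp_in_GL])
  have vel: "velocity c = (\<lambda>t. K ** C ** matrix_exp (t *\<^sub>R C))"
    "velocity (velocity c) = (\<lambda>t. K ** C ** C ** matrix_exp (t *\<^sub>R C))"
    unfolding c_def[abs_def] velocity_mult_matrix_exp by (rule refl)+
  \<comment> \<open>Moving \<open>C\<close> to the right past the exponential exposes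
    \<open>c t\<close> in front, where its inverse can cancel it in the geodesic expression.\<close>
  have "velocity c t = c t ** C" for t
    unfolding vel by (simp add: c_def matrix_mul_assoc[symmetric] matrix_exp_commute)
  moreover have "velocity (velocity c) t = c t ** C ** C" for t
  proof -
    have "matrix_exp (t *\<^sub>R C) ** C ** C = C ** (matrix_exp (t *\<^sub>R C) ** C)"
      unfolding matrix_mul_assoc by (simp only: matrix_exp_commute)
    then show ?thesis
      unfolding vel(2) by (simp add: c_def matrix_mul_assoc[symmetric] matrix_exp_commute)
  qed
  ultimately have "velocity (velocity c) t - velocity c t ** matrix_inv (c t) ** velocity c t = 0" for t
    by (simp add: matrix_mul_assoc GL_matrix_inv[OF GL])
  moreover have "smooth_on UNIV c"
    unfolding c_def[abs_def] by (rule smooth_on_mult_matrix_exp)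
  ultimately have "geodesic GL trace_metric UNIV c"
    using GL by (simp add: geodesic_GL_iff smooth_curve_def is_interval_univ)
  then show ?thesis by (simp add: c_def[abs_def])
qed

lemma smooth_on_velocity:
  assumes "open I" "smooth_on I c"
  shows "smooth_on I (velocity c)"
proof (rule smooth_on_cong[OF assms(1) _ smooth_on_frechet_derivative[OF assms(2), of 1]])
  show "frechet_derivative c (at t) 1 = velocity c t" if "t \<in> I" for t
    using smooth_on_differentiable[OF assms(2) that]
      frechet_derivative_at[of c "\<lambda>h. h *\<^sub>R velocity c t"]
    by (metis has_vector_derivative_def scaleR_one vector_derivative_works velocity_def)
qed

lemma smooth_on_has_vector_derivative:
  "smooth_on I c \<Longrightarrow> t \<in> I \<Longrightarrow> (c has_vector_derivative velocity c t) (at t)"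
  unfolding velocity_def using smooth_on_differentiable vector_derivative_works by blast

text \<open>Two conserved quantities integrate the second-order equation: first
  \<open>matrix_inv (P t) ** velocity P t\<close>, then
  \<open>P t ** matrix_exp (t *\<^sub>R (- C))\<close>. Their constant values are \<open>C\<close>
  and \<open>K\<close>.\<close>

lemma geodesic_GL_imp_matrix_exp:
  fixes P :: "real \<Rightarrow> real^'n^'n"
  assumes "geodesic GL trace_metric I P"
  obtains C K where "K \<in> GL" "\<And>t. t \<in> I \<Longrightarrow> P t = K ** matrix_exp (t *\<^sub>R C)"
proof -
  have I: "open I" "is_interval I" "I \<noteq> {}" and P: "\<And>t. t \<in> I \<Longrightarrow> P t \<in> GL" and sm: "smooth_on I P"
    and eq: "\<And>t. t \<in> I \<Longrightarrow> velocity (velocity P) t = velocity P t ** matrix_inv (P t) ** velocity P t"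
    using assms by (auto simp: geodesic_GL_iff smooth_curve_def)
  note dP = smooth_on_has_vector_derivative[OF sm]
  note dP' = smooth_on_has_vector_derivative[OF smooth_on_velocity[OF I(1) sm]]
  \<comment> \<open>The derivative of the inverse contributes
    \<open>- P\<^sup>-\<^sup>1 P' P\<^sup>-\<^sup>1 P'\<close>, which
    \<open>P\<^sup>-\<^sup>1 P''\<close> cancels by the geodesic equation.\<close>
  have "((\<lambda>t. matrix_inv (P t) ** velocity P t) has_vector_derivative 0) (at t)" if t: "t \<in> I" for t
  proof -
    have "((\<lambda>t. matrix_inv (P t)) has_vector_derivative
        - (matrix_inv (P t) ** velocity P t ** matrix_inv (P t))) (at t)"
      using diff_chain_at[OF dP[OF t, unfolded has_vector_derivative_def] has_derivative_matrix_inv[OF P[OF t]]]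
      by (simp add: has_vector_derivative_def o_def matmul_distribs)
    from matmul.has_vector_derivative[OF this dP'[OF t]] show ?thesis
      by (simp add: eq[OF t] matmul_distribs matrix_mul_assoc)
  qed
  then obtain C where C: "\<And>t. t \<in> I \<Longrightarrow> matrix_inv (P t) ** velocity P t = C"
    using has_vector_derivative_zero_const[OF I(2)] by blast
  have vel: "velocity P t = P t ** C" if "t \<in> I" for t
    by (simp add: C[OF that, symmetric] matrix_mul_assoc GL_matrix_inv[OF P[OF that]])
  \<comment> \<open>The exponential of \<open>- t C\<close> is the integrating factor for
    \<open>P' = P C\<close>.\<close>
  have "((\<lambda>t. P t ** matrix_exp (t *\<^sub>R (- C))) has_vector_derivative 0) (at t)" if t: "t \<in> I" for t
    using matmul.has_vector_derivative[OF dP[OF t] has_vector_derivative_matrix_exp[of "- C" t]]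
    by (simp add: vel[OF t] matmul_distribs matrix_mul_assoc del: scaleR_minus_right)
  then obtain K where K: "\<And>t. t \<in> I \<Longrightarrow> P t ** matrix_exp (t *\<^sub>R (- C)) = K"
    using has_vector_derivative_zero_const[OF I(2)] by blast
  show ?thesis
  proof
    \<comment> \<open>As \<open>I\<close> is nonempty, \<open>K\<close> is an actual product of two
      invertible matrices.\<close>
    show "K \<in> GL" using I(3) K GL_mult[OF P matrix_exp_in_GL] by fast
    show "P t = K ** matrix_exp (t *\<^sub>R C)" if "t \<in> I" for t
      using K[OF that] matrix_exp_mult_uminus[of t "- C"]
      by (simp add: matrix_mul_assoc[symmetric] flip: K[OF that])
  qed
qed

text \<open>The exponential formula found on \<open>I\<close> is a geodesic on the whole line, so
  maximality forces \<open>I = UNIV\<close>; conversely a geodesic on \<open>UNIV\<close> has no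
  larger domain.\<close>

lemma maximal_geodesic_GL_iff:
  fixes P :: "real \<Rightarrow> real^'n^'n"
  shows "maximal_geodesic GL trace_metric I P \<longleftrightarrow>
    I = UNIV \<and> (\<exists>C. \<exists>K\<in>GL. \<forall>t. P t = K ** matrix_exp (t *\<^sub>R C))"
proof
  assume max: "maximal_geodesic GL trace_metric I P"
  then have geod: "geodesic GL trace_metric I P" by (simp add: maximal_geodesic_def)
  have ext: "J = I" if "geodesic GL trace_metric J c" "I \<subseteq> J" "\<forall>t\<in>I. c t = P t" for J c
    using max that by (simp add: maximal_geodesic_def)
  obtain C K where K: "K \<in> GL" and P: "\<And>t. t \<in> I \<Longrightarrow> P t = K ** matrix_exp (t *\<^sub>R C)"
    using geodesic_GL_imp_matrix_exp[OF geod] by metis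
  have "I = UNIV"
    using ext[OF geodesic_mult_matrix_exp[OF K, of C] subset_UNIV] P by simp
  then show "I = UNIV \<and> (\<exists>C. \<exists>K\<in>GL. \<forall>t. P t = K ** matrix_exp (t *\<^sub>R C))"
    using K P by blast
next
  assume "I = UNIV \<and> (\<exists>C. \<exists>K\<in>GL. \<forall>t. P t = K ** matrix_exp (t *\<^sub>R C))"
  then obtain C K where "I = UNIV" "K \<in> GL" "P = (\<lambda>t. K ** matrix_exp (t *\<^sub>R C))" by blast
  then show "maximal_geodesic GL trace_metric I P"
    using geodesic_mult_matrix_exp by (auto simp: maximal_geodesic_def)
qed

theorem theorem2p1:
  fixes G :: "(real^'n^'n) set"
    and g :: "real^'n^'n \<Rightarrow> real^'n^'n \<Rightarrow> real^'n^'n \<Rightarrow> real"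
    and nabla :: "(real^'n^'n \<Rightarrow> real^'n^'n) \<Rightarrow> (real^'n^'n \<Rightarrow> real^'n^'n) \<Rightarrow> real^'n^'n \<Rightarrow> real^'n^'n"
  defines "G \<equiv> GL" and "g \<equiv> trace_metric" and "nabla \<equiv> levi_civita GL trace_metric"
  shows
    "(\<forall>X Y. smooth_on G X \<longrightarrow> smooth_on G Y \<longrightarrow>
        (\<forall>P\<in>G. nabla X Y P = euclidean_derivative X Y P
           - (1/2) *\<^sub>R (X P ** matrix_inv P ** Y P + Y P ** matrix_inv P ** X P)))
   \<and> (\<forall>I P. smooth_curve G I P \<longrightarrow>
        (\<forall>t\<in>I. cov_deriv_along nabla P (velocity P) t
           = velocity (velocity P) t - velocity P t ** matrix_inv (P t) ** velocity P t) \<and>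
        (geodesic G g I P \<longleftrightarrow>
           (\<forall>t\<in>I. velocity (velocity P) t - velocity P t ** matrix_inv (P t) ** velocity P t = 0)))
   \<and> (\<forall>I P. maximal_geodesic G g I P \<longleftrightarrow>
        I = UNIV \<and> (\<exists>C. \<exists>K\<in>G. \<forall>t. P t = K ** matrix_exp (t *\<^sub>R C)))
   \<and> semi_riemannian_manifold G g \<and> geodesically_complete G g"
  unfolding G_def g_def nabla_def
proof (intro conjI allI impI ballI)
  show "levi_civita GL trace_metric X Y P = euclidean_derivative X Y P
      - (1/2) *\<^sub>R (X P ** matrix_inv P ** Y P + Y P ** matrix_inv P ** X P)"
    if "smooth_on GL X" "smooth_on GL Y" "P \<in> GL" for X Y and P :: "real^'n^'n"
    using levi_civita_GL[OF that] by (simp add: trace_connection_def)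
  fix I and P :: "real \<Rightarrow> real^'n^'n"
  assume c: "smooth_curve GL I P"
  show "cov_deriv_along (levi_civita GL trace_metric) P (velocity P) t
      = velocity (velocity P) t - velocity P t ** matrix_inv (P t) ** velocity P t" if "t \<in> I" for t
    using c that by (intro cov_deriv_along_velocity_GL) (simp add: smooth_curve_def)
  show "geodesic GL trace_metric I P \<longleftrightarrow>
      (\<forall>t\<in>I. velocity (velocity P) t - velocity P t ** matrix_inv (P t) ** velocity P t = 0)"
    using c by (simp add: geodesic_GL_iff)
next
  show "maximal_geodesic GL trace_metric I P \<longleftrightarrow>
      I = UNIV \<and> (\<exists>C. \<exists>K\<in>GL. \<forall>t. P t = K ** matrix_exp (t *\<^sub>R C))" for I and P :: "real \<Rightarrow> real^'n^'n"
    by (rule maximal_geodesic_GL_iff)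
  show "semi_riemannian_manifold (GL :: (real^'n^'n) set) trace_metric"
    by (rule semi_riemannian_manifold_GL)
  \<comment> \<open>Completeness is the \<open>I = UNIV\<close> half of the classification of
    maximal geodesics.\<close>
  show "geodesically_complete (GL :: (real^'n^'n) set) trace_metric"
    by (simp add: geodesically_complete_def maximal_geodesic_GL_iff)
qed

end
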